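(* If a path-connected metric space $(X,d)$ admits a Lipschitz mixer, then it has bounded turning.
   Context: For a metric space $(X,d)$, the power $X^3$ carries the metric $d(a,b)=\sum_{k=1}^3 d(a_k,b_k)$. A mixer on $X$ is a continuous map $\sigma\colon X^3\to X$ such that $\sigma(a,a,b)=\sigma(a,b,a)=\sigma(b,a,a)=a$ for all $a,b\in X$. A Lipschitz mixer is a mixer that is a Lipschitz map. A metric space $X$ has bounded turning if there exists a constant $C$ such that any two points $a,b\in X$ are contained in some compact connected set $E\subset X$ with $\operatorname{diam}E\le C\,d(a,b)$. *)

theory Defs
  imports "HOL-Analysis.Analysis"
begin

text \<open>The library's \<^const>\<open>prod_metric\<close> is the Euclidean combination of the
  factor metrics, so the sum metric on the cube is introduced here.\<close>

definition cube_dist :: "'a metric \<Rightarrow> 'a \<times> 'a \<times> 'a \<Rightarrow> 'a \<times> 'a \<times> 'a \<Rightarrow> real" where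
  "cube_dist X = (\<lambda>(a1, a2, a3) (b1, b2, b3). mdist X a1 b1 + mdist X a2 b2 + mdist X a3 b3)"

lemma Metric_space_cube:
  "Metric_space (mspace X \<times> mspace X \<times> mspace X) (cube_dist X)"
proof
  fix x y :: "'a \<times> 'a \<times> 'a"
  show "0 \<le> cube_dist X x y"
    by (cases x; cases y) (simp add: cube_dist_def)
  show "cube_dist X x y = cube_dist X y x"
    by (cases x; cases y) (simp add: cube_dist_def mdist_commute)
next
  fix x y :: "'a \<times> 'a \<times> 'a"
  assume "x \<in> mspace X \<times> mspace X \<times> mspace X" "y \<in> mspace X \<times> mspace X \<times> mspace X"
  then show "cube_dist X x y = 0 \<longleftrightarrow> x = y"
    by (cases x; cases y) (simp add: cube_dist_def add_nonneg_eq_0_iff)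
next
  fix x y z :: "'a \<times> 'a \<times> 'a"
  assume "x \<in> mspace X \<times> mspace X \<times> mspace X" "y \<in> mspace X \<times> mspace X \<times> mspace X"
    "z \<in> mspace X \<times> mspace X \<times> mspace X"
  then show "cube_dist X x z \<le> cube_dist X x y + cube_dist X y z"
  proof (clarsimp simp: cube_dist_def, goal_cases)
    case (1 x1 x2 x3 y1 y2 y3 z1 z2 z3)
    then show ?case
      using mdist_triangle[of x1 X y1 z1] mdist_triangle[of x2 X y2 z2]
        mdist_triangle[of x3 X y3 z3] by linarith
  qed
qed

definition cube_metric :: "'a metric \<Rightarrow> ('a \<times> 'a \<times> 'a) metric" where
  "cube_metric X = metric (mspace X \<times> mspace X \<times> mspace X, cube_dist X)"

lemma mspace_cube_metric [simp]:
  "mspace (cube_metric X) = mspace X \<times> mspace X \<times> mspace X"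
  by (simp add: cube_metric_def Metric_space.mspace_metric Metric_space_cube)

lemma mdist_cube_metric [simp]: "mdist (cube_metric X) = cube_dist X"
  by (simp add: cube_metric_def Metric_space.mdist_metric Metric_space_cube)

definition mixer :: "'a metric \<Rightarrow> ('a \<times> 'a \<times> 'a \<Rightarrow> 'a) \<Rightarrow> bool" where
  "mixer X \<sigma> \<longleftrightarrow>
     continuous_map (mtopology_of (cube_metric X)) (mtopology_of X) \<sigma> \<and>
     (\<forall>a\<in>mspace X. \<forall>b\<in>mspace X. \<sigma> (a, a, b) = a \<and> \<sigma> (a, b, a) = a \<and> \<sigma> (b, a, a) = a)"

definition Lipschitz_mixer :: "'a metric \<Rightarrow> ('a \<times> 'a \<times> 'a \<Rightarrow> 'a) \<Rightarrow> bool" where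
  "Lipschitz_mixer X \<sigma> \<longleftrightarrow> mixer X \<sigma> \<and> Lipschitz_continuous_map (cube_metric X) X \<sigma>"

text \<open>As for the library's \<^const>\<open>diameter\<close>, the supremum is real-valued and hence meaningful
  only for bounded sets; below it is applied to compact sets only.\<close>

definition mdiameter :: "'a metric \<Rightarrow> 'a set \<Rightarrow> real" where
  "mdiameter X S = (if S = {} then 0 else SUP (x, y) \<in> S \<times> S. mdist X x y)"

lemma mdiameter_euclidean: "mdiameter euclidean_metric S = diameter S"
  by (simp add: mdiameter_def diameter_def)

definition bounded_turning :: "'a metric \<Rightarrow> bool" where
  "bounded_turning X \<longleftrightarrow>
     (\<exists>C::real. \<forall>a\<in>mspace X. \<forall>b\<in>mspace X.
        \<exists>E. compactin (mtopology_of X) E \<and> connectedin (mtopology_of X) E \<and>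
            a \<in> E \<and> b \<in> E \<and> mdiameter X E \<le> C * mdist X a b)"

end

theory Submission
  imports Defs
begin

text \<open>If \<open>\<gamma>\<close> is a path from \<open>a\<close> to \<open>b\<close>, then so is \<open>t \<mapsto> \<sigma> (a, b, \<gamma> t)\<close>, because
  \<open>\<sigma> (a, b, a) = a\<close> and \<open>\<sigma> (a, b, b) = b\<close>. As \<open>\<sigma> (a, a, x) = a\<close>, the Lipschitz condition
  in the second variable alone keeps this path within distance \<open>L * d(a, b)\<close> of \<open>a\<close>, however
  far \<open>\<gamma>\<close> strays.\<close>

lemma mdist_self: "x \<in> mspace X \<Longrightarrow> mdist X x x = 0"
  by simp

text \<open>The slice x \<mapsto> (a, b, x) is an isometric embedding for the sum metric, since the
  first two summands vanish. The lemma supplies the continuity needed to compose the slice of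
  \<sigma> with a path.\<close>

lemma Lipschitz_continuous_map_cube_third:
  assumes \<sigma>: "Lipschitz_continuous_map (cube_metric X) Y \<sigma>"
    and a: "a \<in> mspace X" and b: "b \<in> mspace X"
  shows "Lipschitz_continuous_map X Y (\<lambda>x. \<sigma> (a, b, x))"
  unfolding Lipschitz_continuous_map_def
proof (intro conjI)
  show "(\<lambda>x. \<sigma> (a, b, x)) \<in> mspace X \<rightarrow> mspace Y"
    using Lipschitz_continuous_map_image[OF \<sigma>] a b by auto
  obtain L where L: "\<And>p q. p \<in> mspace (cube_metric X) \<Longrightarrow> q \<in> mspace (cube_metric X) \<Longrightarrow>
      mdist Y (\<sigma> p) (\<sigma> q) \<le> L * cube_dist X p q"
    using \<sigma> unfolding Lipschitz_continuous_map_def mdist_cube_metric by blast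
  have "mdist Y (\<sigma> (a, b, x)) (\<sigma> (a, b, y)) \<le> L * mdist X x y"
    if "x \<in> mspace X" "y \<in> mspace X" for x y
    using L[of "(a, b, x)" "(a, b, y)"] a b that by (simp add: cube_dist_def mdist_self)
  then show "\<exists>B. \<forall>x\<in>mspace X. \<forall>y\<in>mspace X.
      mdist Y (\<sigma> (a, b, x)) (\<sigma> (a, b, y)) \<le> B * mdist X x y"
    by blast
qed

text \<open>Triangle inequality through the centre \<open>a\<close>. The bound
  \<open>0 \<le> r\<close> covers the empty set, whose \<open>mdiameter\<close> is 0.\<close>

lemma mdiameter_le_double_radius:
  assumes "a \<in> mspace X" and "0 \<le> r"
    and "\<And>x. x \<in> E \<Longrightarrow> x \<in> mspace X \<and> mdist X a x \<le> r"
  shows "mdiameter X E \<le> 2 * r"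
proof (cases "E = {}")
  case True
  then show ?thesis using \<open>0 \<le> r\<close> by (simp add: mdiameter_def)
next
  case False
  have "mdist X x y \<le> 2 * r" if "x \<in> E" "y \<in> E" for x y
    using assms(3)[OF that(1)] assms(3)[OF that(2)] assms(1)
      mdist_triangle[of x X a y] mdist_commute[of X x a] by linarith
  with False show ?thesis
    by (auto simp: mdiameter_def intro!: cSUP_least)
qed

theorem proposition3p2:
  fixes X :: "'a metric"
  assumes "path_connected_space (mtopology_of X)"
    and "\<exists>\<sigma>. Lipschitz_mixer X \<sigma>"
  shows "bounded_turning X"
proof -
  obtain \<sigma> where mix: "\<And>a b. a \<in> mspace X \<Longrightarrow> b \<in> mspace X \<Longrightarrow>
      \<sigma> (a, a, b) = a \<and> \<sigma> (a, b, a) = a \<and> \<sigma> (b, a, a) = a"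
    and lip: "Lipschitz_continuous_map (cube_metric X) X \<sigma>"
    using assms(2) unfolding Lipschitz_mixer_def mixer_def by blast
  \<comment> \<open>Positivity makes \<open>L * mdist X a b\<close> a legitimate radius.
    \<open>L\<close> is fixed before the points and the path, so the turning constant
    \<open>2 * L\<close> is uniform.\<close>
  from lip obtain L where L: "L > 0" "\<And>p q. p \<in> mspace (cube_metric X) \<Longrightarrow>
      q \<in> mspace (cube_metric X) \<Longrightarrow> mdist X (\<sigma> p) (\<sigma> q) \<le> L * cube_dist X p q"
    unfolding Lipschitz_continuous_map_pos mdist_cube_metric by blast
  have "\<exists>E. compactin (mtopology_of X) E \<and> connectedin (mtopology_of X) E \<and>
      a \<in> E \<and> b \<in> E \<and> mdiameter X E \<le> 2 * L * mdist X a b"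
    if a: "a \<in> mspace X" and b: "b \<in> mspace X" for a b
  proof -
    let ?f = "\<lambda>x. \<sigma> (a, b, x)"
    obtain g where g: "pathin (mtopology_of X) g" "g 0 = a" "g 1 = b"
      using assms(1) a b by (auto simp: path_connected_space_def)
    have "continuous_map (mtopology_of X) (mtopology_of X) ?f"
      by (intro Lipschitz_continuous_imp_continuous_map
          Lipschitz_continuous_map_cube_third lip a b)
    then have path: "pathin (mtopology_of X) (?f \<circ> g)"
      by (rule pathin_compose[OF g(1)])
    define E where "E = (?f \<circ> g) ` {0..1}"
    have near: "x \<in> mspace X \<and> mdist X a x \<le> L * mdist X a b" if xE: "x \<in> E" for x
    proof -
      obtain t where t: "t \<in> {0..1}" "x = \<sigma> (a, b, g t)"
        using xE by (auto simp: E_def)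
      have gt: "g t \<in> mspace X"
        using path_image_subset_topspace[OF g(1)] t(1) by auto
      have "x \<in> mspace X"
        using path_image_subset_topspace[OF path] t by auto
      \<comment> \<open>The two triples differ only in the second entry, so their distance in the
        cube is exactly d(a, b), and \<sigma> sends the first one to \<open>a\<close>.\<close>
      then show ?thesis
        using L(2)[of "(a, a, g t)" "(a, b, g t)"] mix[OF a gt] a b gt t(2)
        by (simp add: cube_dist_def mdist_self)
    qed
    \<comment> \<open>The endpoint \<open>b\<close> comes from the third mixer identity with the
      roles of \<open>a\<close> and \<open>b\<close> exchanged.\<close>
    have "(?f \<circ> g) 0 = a" "(?f \<circ> g) 1 = b"
      using mix[OF a b] mix[OF b a] g(2,3) by auto
    then have "a \<in> E" "b \<in> E"
      unfolding E_def by (metis atLeastAtMost_iff image_eqI order_refl zero_le_one)+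
    moreover have "compactin (mtopology_of X) E" "connectedin (mtopology_of X) E"
      unfolding E_def using path
      by (rule compactin_path_image connectedin_path_image)+
    moreover have "mdiameter X E \<le> 2 * (L * mdist X a b)"
      using L(1) near by (intro mdiameter_le_double_radius[OF a]) auto
    ultimately show ?thesis by (auto simp: mult.assoc)
  qed
  then show ?thesis unfolding bounded_turning_def by blast
qed

end
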